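(* Let $n$ be a positive integer. For every Stirling permutation $w\in Q_n$, the total displacement satisfies $d(w)=n^2$.
   Context: A Stirling permutation of order $n$ is a permutation $w = w(1)w(2)\cdots w(2n)$ of the multiset $\{1,1,2,2,\ldots,n,n\}$ such that any value $j$ appearing between the two instances of $i$ satisfies $j>i$. $Q_n$ denotes the set of Stirling permutations of order $n$. Parking interpretation: there is a one-way street with spots $1,\ldots,2n$ (in this order), and cars $1,2,\ldots,2n$ arrive in order, car $i$ having preferred spot $w(i)$. Car $i$ parks in spot $w(i)$ if it is available; otherwise it continues down the street and parks in the first available spot after $w(i)$. For every $w\in Q_n$ all cars park. If car $i$ parks in spot $p(i)$, its displacement is $d(i)=p(i)-w(i)$. The total displacement of $w$ is $d(w)=\sum_{i=1}^{2n}d(i)$. *)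

theory Defs
  imports Complex_Main "HOL-Library.Multiset"
begin

text \<open>Words are lists: the letter written \<open>w(i)\<close> with \<open>i \<ge> 1\<close> is \<open>w ! (i - 1)\<close>.
  Every value occurs exactly twice, so two distinct positions with equal letters are exactly the
  two instances of that value.\<close>

definition stirling_permutations :: "nat \<Rightarrow> nat list set" where
  "stirling_permutations n =
     {w. mset w = mset_set {1..n} + mset_set {1..n} \<and>
         (\<forall>a b c. a < b \<and> b < c \<and> c < length w \<and> w ! a = w ! c \<longrightarrow> w ! b > w ! a)}"

text \<open>The spot taken by a car with preference \<open>a\<close> on a street with spots \<open>1, \<dots>, m\<close>, of which those
  in \<open>T\<close> are taken: \<open>a\<close> if it is free, else the first free spot after \<open>a\<close>; \<open>None\<close> if the
  car reaches the end of the street without finding a free spot.\<close>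

definition first_free :: "nat \<Rightarrow> nat set \<Rightarrow> nat \<Rightarrow> nat option" where
  "first_free m T a =
     (if \<exists>s\<in>{a..m}. s \<notin> T then Some (LEAST s. s \<in> {a..m} \<and> s \<notin> T) else None)"

primrec parking :: "nat \<Rightarrow> nat set \<Rightarrow> nat list \<Rightarrow> nat option list" where
  "parking m T [] = []"
| "parking m T (a # w) =
     first_free m T a # parking m (T \<union> set_option (first_free m T a)) w"

text \<open>The street has as many spots as there are cars and is empty at the beginning. The use of
  \<open>the\<close> is harmless for Stirling permutations, by \<open>stirling_all_cars_park\<close> below.\<close>

definition parking_spot :: "nat list \<Rightarrow> nat \<Rightarrow> nat" where
  "parking_spot w i = the (parking (length w) {} w ! (i - 1))"

definition displacement :: "nat list \<Rightarrow> nat \<Rightarrow> int" where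
  "displacement w i = int (parking_spot w i) - int (w ! (i - 1))"

definition total_displacement :: "nat list \<Rightarrow> int" where
  "total_displacement w = (\<Sum>i = 1..length w. displacement w i)"

lemma length_parking [simp]: "length (parking m T w) = length w"
  by (induction w arbitrary: T) auto

definition taken_after :: "nat \<Rightarrow> nat set \<Rightarrow> nat list \<Rightarrow> nat set" where
  "taken_after m T w = T \<union> \<Union>(set_option ` set (parking m T w))"

lemma taken_after_Nil [simp]: "taken_after m T [] = T"
  by (simp add: taken_after_def)

lemma taken_after_Cons [simp]:
  "taken_after m T (a # w) = taken_after m (T \<union> set_option (first_free m T a)) w"
  by (auto simp: taken_after_def)

lemma taken_after_superset: "T \<subseteq> taken_after m T w"
  by (auto simp: taken_after_def)

lemma None_in_parking:
  "None \<in> set (parking m T w) \<Longrightarrow>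
     \<exists>u a v. w = u @ a # v \<and> first_free m (taken_after m T u) a = None"
proof (induction w arbitrary: T)
  case (Cons b w)
  show ?case
  proof (cases "first_free m T b")
    case None
    then show ?thesis by (intro exI[of _ "[]"]) auto
  next
    case (Some s)
    with Cons.prems have "None \<in> set (parking m (T \<union> set_option (first_free m T b)) w)"
      by auto
    from Cons.IH[OF this] obtain u a v where
      "w = u @ a # v"
      "first_free m (taken_after m (T \<union> set_option (first_free m T b)) u) a = None"
      by blast
    then show ?thesis by (intro exI[of _ "b # u"] exI[of _ a] exI[of _ v]) simp
  qed
qed simp

lemma first_free_le:
  assumes "a \<le> k" "k \<le> m" "k \<notin> T" "first_free m T a = Some s"
  shows "s \<le> k"
  using assms by (auto simp: first_free_def split: if_splits intro!: Least_le)

lemma finite_taken_after: "finite T \<Longrightarrow> finite (taken_after m T w)"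
  by (auto simp: taken_after_def)

lemma card_taken_after:
  assumes "finite T"
  shows "card (taken_after m T w) \<le> card T + length w"
  using assms
proof (induction w arbitrary: T)
  case (Cons a w)
  have "card (T \<union> set_option (first_free m T a)) \<le> Suc (card T)"
    using Cons.prems by (cases "first_free m T a") (auto simp: card_insert_if)
  then show ?case
    using Cons.IH[of "T \<union> set_option (first_free m T a)"] Cons.prems by simp
qed simp

lemma card_taken_after_greater:
  assumes "finite T" "k \<le> m" "k \<notin> taken_after m T w"
  shows "card (taken_after m T w \<inter> {k<..}) \<le>
           card (T \<inter> {k<..}) + length (filter (\<lambda>a. k < a) w)"
  using assms
proof (induction w arbitrary: T)
  case (Cons a w)
  let ?T = "T \<union> set_option (first_free m T a)"
  have "k \<notin> T"
    using taken_after_superset[of T m "a # w"] Cons.prems by blast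
  have "card (?T \<inter> {k<..}) \<le> card (T \<inter> {k<..}) + (if k < a then 1 else 0)"
  proof (cases "first_free m T a")
    case (Some s)
    show ?thesis
    proof (cases "k < a")
      case True
      have "card (?T \<inter> {k<..}) \<le> card (insert s (T \<inter> {k<..}))"
        using Cons.prems Some by (intro card_mono) auto
      then show ?thesis
        using True Cons.prems by (auto simp: card_insert_if split: if_splits)
    next
      case False
      then have "s \<le> k" using first_free_le[OF _ _ \<open>k \<notin> T\<close> Some] Cons.prems by simp
      then have "?T \<inter> {k<..} = T \<inter> {k<..}" using Some by auto
      then show ?thesis by simp
    qed
  qed simp
  then show ?case
    using Cons.IH[of ?T] Cons.prems by (auto split: if_splits)
qed simp

lemma length_stirling:
  assumes "w \<in> stirling_permutations n"
  shows "length w = 2 * n"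
proof -
  have "size (mset w) = 2 * n" using assms by (auto simp: stirling_permutations_def)
  then show ?thesis by simp
qed

lemma stirling_all_cars_park:
  assumes "w \<in> stirling_permutations n"
  shows "None \<notin> set (parking (length w) {} w)"
proof
  let ?m = "2 * n"
  assume "None \<in> set (parking (length w) {} w)"
  then obtain u a v where w: "w = u @ a # v"
    and none: "first_free ?m (taken_after ?m {} u) a = None"
    using None_in_parking length_stirling[OF assms] by metis
  define F where "F = taken_after ?m {} u"
  have fin: "finite F" by (simp add: F_def finite_taken_after)
  have "length u < ?m" using length_stirling[OF assms] w by simp
  moreover have "card F \<le> length u" using card_taken_after[of "{}" ?m u] by (simp add: F_def)
  ultimately have "\<not> {1..?m} \<subseteq> F" using card_mono[OF fin, of "{1..?m}"] by auto
  then have ne: "{1..?m} - F \<noteq> {}" by blast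
  define k where "k = Max ({1..?m} - F)"
  have k: "k \<in> {1..?m} - F" unfolding k_def using ne by (intro Max_in) auto
  have up: "s \<in> F" if "k < s" "s \<le> ?m" for s
  proof (rule ccontr)
    assume "s \<notin> F"
    with that k have "s \<le> k" unfolding k_def by (intro Max_ge) auto
    with that show False by simp
  qed
  have "k < a"
  proof (rule ccontr)
    assume "\<not> k < a"
    then have "\<exists>s\<in>{a..?m}. s \<notin> F" using k by (intro bexI[of _ k]) auto
    then show False using none by (simp add: first_free_def F_def)
  qed
  have "?m - k = card {k<..?m}" by simp
  also have "\<dots> \<le> card (F \<inter> {k<..})" using fin up by (intro card_mono) auto
  also have "\<dots> \<le> length (filter (\<lambda>a. k < a) u)"
    using card_taken_after_greater[of "{}" k ?m u] k by (simp add: F_def)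
  also have "\<dots> < length (filter (\<lambda>a. k < a) w)" using w \<open>k < a\<close> by simp
  also have "\<dots> = size (filter_mset (\<lambda>a. k < a) (mset w))" by (metis mset_filter size_mset)
  also have "\<dots> = 2 * card {i \<in> {1..n}. k < i}"
    using assms by (simp add: stirling_permutations_def filter_mset_mset_set)
  also have "{i \<in> {1..n}. k < i} = {k<..n}" by auto
  finally show False by simp
qed

end

(* When all cars park, the occupied spots are exactly 1, ..., length w, so the total displacement
   is the sum of all spots minus the sum of all preferences and depends only on the multiset of
   letters. For a Stirling permutation it is n(2n + 1) - n(n + 1). *)
theory Submission
  imports Defs
begin

lemma first_free_Some:
  assumes "first_free m T a = Some s"
  shows "a \<le> s" "s \<le> m" "s \<notin> T"
proof -
  have "\<exists>s. s \<in> {a..m} \<and> s \<notin> T" and s: "s = (LEAST s. s \<in> {a..m} \<and> s \<notin> T)"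
    using assms by (auto simp: first_free_def split: if_splits)
  from LeastI_ex[OF this(1)] show "a \<le> s" "s \<le> m" "s \<notin> T"
    unfolding s by auto
qed

text \<open>Arbitrary \<open>T\<close> makes the induction work: each car's spot joins the taken
  set, so all later cars avoid it. Since a car never moves backwards, the bound
  \<open>1 \<le> a\<close> on preferences keeps its spot at least 1. Excluding \<open>None\<close>
  ensures that \<open>the\<close> is only applied to actual spots.\<close>

lemma parking_spots_distinct:
  assumes "None \<notin> set (parking m T w)" "\<forall>a\<in>set w. 1 \<le> a"
  shows "distinct (map the (parking m T w)) \<and> the ` set (parking m T w) \<subseteq> {1..m} - T"
  using assms
proof (induction w arbitrary: T)
  case (Cons a w)
  then obtain s where s: "first_free m T a = Some s"
    by (cases "first_free m T a") auto
  have "distinct (map the (parking m (insert s T) w)) \<and>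
      the ` set (parking m (insert s T) w) \<subseteq> {1..m} - insert s T"
    using Cons.IH[of "insert s T"] Cons.prems s by auto
  then show ?case
    using first_free_Some[OF s] Cons.prems s by auto
qed simp

text \<open>Pigeonhole: \<open>length w\<close> distinct spots inside a set of that size must fill
  it.\<close>

lemma set_parking_spots:
  assumes "None \<notin> set (parking (length w) {} w)" "\<forall>a\<in>set w. 1 \<le> a"
  shows "the ` set (parking (length w) {} w) = {1..length w}"
proof (rule card_subset_eq)
  show "the ` set (parking (length w) {} w) \<subseteq> {1..length w}"
    using parking_spots_distinct[OF assms] by simp
  show "card (the ` set (parking (length w) {} w)) = card {1..length w}"
    using distinct_card[of "map the (parking (length w) {} w)"] parking_spots_distinct[OF assms]
    by simp
qed simp

lemma total_displacement_eq_sums: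
  assumes "None \<notin> set (parking (length w) {} w)" "\<forall>a\<in>set w. 1 \<le> a"
  shows "total_displacement w = int (\<Sum>{1..length w}) - int (sum_list w)"
proof -
  let ?p = "map the (parking (length w) {} w)"
  have "total_displacement w = (\<Sum>i<length w. int (?p ! i) - int (w ! i))"
    unfolding total_displacement_def displacement_def parking_spot_def
    \<comment> \<open>Cars are numbered from 1, list positions from 0; as \<open>i \<ge> 1\<close>,
      \<open>Suc\<close> inverts the truncated subtraction.\<close>
    by (rule sum.reindex_bij_witness[of _ Suc "\<lambda>i. i - 1"]) auto
  also have "\<dots> = int (\<Sum>i<length w. ?p ! i) - int (\<Sum>i<length w. w ! i)"
    by (simp add: sum_subtractf)
  also have "(\<Sum>i<length w. ?p ! i) = sum_list ?p"
    by (simp add: sum_list_sum_nth atLeast0LessThan)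
  also have "\<dots> = \<Sum>(set ?p)"
    using parking_spots_distinct[OF assms] by (simp add: distinct_sum_list_conv_Sum)
  also have "set ?p = {1..length w}"
    using set_parking_spots[OF assms] by simp
  also have "(\<Sum>i<length w. w ! i) = sum_list w"
    by (simp add: sum_list_sum_nth atLeast0LessThan)
  finally show ?thesis .
qed

theorem corollary5p3:
  fixes n :: nat and w :: "nat list"
  assumes "n > 0" and "w \<in> stirling_permutations n"
  shows "total_displacement w = (int n)\<^sup>2"
proof -
  have w: "mset w = mset_set {1..n} + mset_set {1..n}"
    using assms by (simp add: stirling_permutations_def)
  have "set w = set_mset (mset_set {1..n} + mset_set {1..n})"
    by (metis w set_mset_mset)
  then have ge: "\<forall>a\<in>set w. 1 \<le> a" by simp
  \<comment> \<open>Passing to the multiset forgets the order of the letters but keeps both copies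
    of each.\<close>
  have "sum_list w = sum_mset (mset_set {1..n} + mset_set {1..n})"
    by (metis w sum_mset_sum_list)
  then have sum: "sum_list w = 2 * \<Sum>{1..n}"
    by (simp add: sum_unfold_sum_mset mult_2)
  \<comment> \<open>The doubled form avoids division in \<open>nat\<close>. It serves twice:
    \<open>k = 2 * n\<close> for the spots and \<open>k = n\<close> for the letters.\<close>
  have gauss: "2 * \<Sum>{1..k} = k * (k + 1)" for k :: nat
    by (induction k) auto
  have "2 * \<Sum>{1..length w} = 2 * n * (2 * n + 1)"
    using gauss[of "2 * n"] length_stirling[OF assms(2)] by simp
  then have "\<Sum>{1..length w} = n * (2 * n + 1)" by simp
  then show ?thesis
    unfolding total_displacement_eq_sums[OF stirling_all_cars_park[OF assms(2)] ge] sum gauss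
    by (simp add: power2_eq_square algebra_simps)
qed

end
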